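(* Let $\Sigma$ be a structurally well-posed $n\times n$ signature matrix. Each coarse block of $\Sigma$ is the union of the fine blocks comprising a strong component of the fine-block graph of $\Sigma$. (A block is a pair $(R,C)$ of a set of row labels and a set of column labels, and the union of blocks $(R_l,C_l)$ is $(\bigcup_l R_l,\bigcup_l C_l)$.)
   Context: A signature matrix is an $n\times n$ matrix $\Sigma=(\sigma_{ij})$ with entries in $\mathbb{Z}_{\ge0}\cup\{-\infty\}$. A transversal is a set $T$ of $n$ positions $(i,j)$ with exactly one in each row and each column; its value is $\sum_{(i,j)\in T}\sigma_{ij}$. $\Sigma$ is structurally well-posed if it has a transversal on which all $\sigma_{ij}$ are finite. A highest-value transversal (HVT) is a transversal of maximal value. The essential sparsity pattern $S_{\mathrm{ess}}$ is the union of all HVTs of $\Sigma$. The sparsity pattern of $\Sigma$ is $S=\{(i,j):\sigma_{ij}>-\infty\}$. A permuted square-block form consists of permutations $\rho$ (of rows) and $\kappa$ (of columns) of $\{1,\ldots,n\}$ and positive integers $N_1,\ldots,N_p$ summing to $n$; put $B_l=\{i : \sum_{r<l}N_r < i\le \sum_{r\le l}N_r\}$, $R_l=\rho(B_l)$, $C_l=\kappa(B_l)$. It puts a pattern $A\subseteq\{1,\ldots,n\}^2$ into (upper) block-triangular form (BTF) if $A\cap(R_k\times C_l)=\emptyset$ whenever $k>l$. A pattern containing a transversal is irreducible if no such form with $p>1$ puts it into BTF. A BTF is irreducible if each diagonal sub-pattern $A\cap(R_l\times C_l)$ is irreducible (as an $N_l\times N_l$ pattern). Every pattern containing a transversal has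 an irreducible BTF, and the set of pairs $\{(R_1,C_1),\ldots,(R_p,C_p)\}$ is the same for every irreducible BTF of $A$; it is called the irreducible emblem of $A$. The fine blocks of $\Sigma$ are the pairs $(R_l,C_l)$ in the irreducible emblem of $S_{\mathrm{ess}}$. The coarse blocks of $\Sigma$ are the pairs in the irreducible emblem of $S$. The fine-block graph of $\Sigma$ (ignoring its edge weights, which are irrelevant here) is the digraph whose vertices are the fine blocks, enumerated $(R_1,C_1),\ldots,(R_p,C_p)$ in some order, with an edge $k\to l$ for each pair $k\ne l$ with $S\cap(R_k\times C_l)\ne\emptyset$. Strong components of a digraph are the equivalence classes of vertices under mutual reachability by directed paths (zero-length paths allowed). *)

theory Defs
  imports "HOL-Library.Extended_Real" "HOL-Combinatorics.Permutations"
begin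

text \<open>
  Rows and columns are labelled by \<open>{1..n}\<close>. Values of a matrix or of a permutation outside this
  range are irrelevant.
\<close>

definition signature_matrix :: "nat \<Rightarrow> (nat \<Rightarrow> nat \<Rightarrow> ereal) \<Rightarrow> bool" where
  "signature_matrix n \<sigma> \<longleftrightarrow>
     (\<forall>i\<in>{1..n}. \<forall>j\<in>{1..n}. \<sigma> i j = -\<infinity> \<or> (\<exists>k::nat. \<sigma> i j = ereal (real k)))"

definition transversal :: "nat \<Rightarrow> (nat \<times> nat) set \<Rightarrow> bool" where
  "transversal n T \<longleftrightarrow> T \<subseteq> {1..n} \<times> {1..n} \<and>
     (\<forall>i\<in>{1..n}. \<exists>!j. (i, j) \<in> T) \<and> (\<forall>j\<in>{1..n}. \<exists>!i. (i, j) \<in> T)"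

text \<open>
  The sum of extended reals is \<open>-\<infinity>\<close> as soon as one summand is \<open>-\<infinity>\<close> and none is \<open>\<infinity>\<close>.
\<close>

definition transversal_value :: "(nat \<Rightarrow> nat \<Rightarrow> ereal) \<Rightarrow> (nat \<times> nat) set \<Rightarrow> ereal" where
  "transversal_value \<sigma> T = (\<Sum>(i, j)\<in>T. \<sigma> i j)"

definition structurally_well_posed :: "nat \<Rightarrow> (nat \<Rightarrow> nat \<Rightarrow> ereal) \<Rightarrow> bool" where
  "structurally_well_posed n \<sigma> \<longleftrightarrow>
     (\<exists>T. transversal n T \<and> (\<forall>(i, j)\<in>T. \<bar>\<sigma> i j\<bar> \<noteq> \<infinity>))"

definition highest_value_transversal ::
    "nat \<Rightarrow> (nat \<Rightarrow> nat \<Rightarrow> ereal) \<Rightarrow> (nat \<times> nat) set \<Rightarrow> bool" where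
  "highest_value_transversal n \<sigma> T \<longleftrightarrow> transversal n T \<and>
     (\<forall>T'. transversal n T' \<longrightarrow> transversal_value \<sigma> T' \<le> transversal_value \<sigma> T)"

definition sparsity_pattern :: "nat \<Rightarrow> (nat \<Rightarrow> nat \<Rightarrow> ereal) \<Rightarrow> (nat \<times> nat) set" where
  "sparsity_pattern n \<sigma> = {(i, j). i \<in> {1..n} \<and> j \<in> {1..n} \<and> \<sigma> i j > -\<infinity>}"

definition essential_pattern :: "nat \<Rightarrow> (nat \<Rightarrow> nat \<Rightarrow> ereal) \<Rightarrow> (nat \<times> nat) set" where
  "essential_pattern n \<sigma> = \<Union>{T. highest_value_transversal n \<sigma> T}"

text \<open>
  A permuted square-block form is given by \<open>\<rho>\<close>, \<open>\<kappa>\<close>, the number \<open>p\<close> of blocks and the block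
  sizes \<open>N 1, \<dots>, N p\<close>. The \<open>l\<close>-th block is \<open>(\<rho> ` index_block N l, \<kappa> ` index_block N l)\<close>.
\<close>

definition square_block_form ::
    "nat \<Rightarrow> (nat \<Rightarrow> nat) \<Rightarrow> (nat \<Rightarrow> nat) \<Rightarrow> nat \<Rightarrow> (nat \<Rightarrow> nat) \<Rightarrow> bool" where
  "square_block_form n \<rho> \<kappa> p N \<longleftrightarrow> \<rho> permutes {1..n} \<and> \<kappa> permutes {1..n} \<and>
     (\<forall>l\<in>{1..p}. N l > 0) \<and> (\<Sum>l\<in>{1..p}. N l) = n"

definition index_block :: "(nat \<Rightarrow> nat) \<Rightarrow> nat \<Rightarrow> nat set" where
  "index_block N l = {(\<Sum>r\<in>{1..<l}. N r)<..(\<Sum>r\<in>{1..l}. N r)}"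

definition block_triangular_form ::
    "nat \<Rightarrow> (nat \<times> nat) set \<Rightarrow> (nat \<Rightarrow> nat) \<Rightarrow> (nat \<Rightarrow> nat) \<Rightarrow> nat \<Rightarrow> (nat \<Rightarrow> nat) \<Rightarrow> bool" where
  "block_triangular_form n A \<rho> \<kappa> p N \<longleftrightarrow> square_block_form n \<rho> \<kappa> p N \<and>
     (\<forall>k\<in>{1..p}. \<forall>l\<in>{1..p}. k > l \<longrightarrow> A \<inter> (\<rho> ` index_block N k \<times> \<kappa> ` index_block N l) = {})"

definition irreducible_pattern :: "nat \<Rightarrow> (nat \<times> nat) set \<Rightarrow> bool" where
  "irreducible_pattern n A \<longleftrightarrow> (\<exists>T. transversal n T \<and> T \<subseteq> A) \<and>
     \<not> (\<exists>\<rho> \<kappa> p N. p > 1 \<and> block_triangular_form n A \<rho> \<kappa> p N)"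

text \<open>
  The part of \<open>A\<close> in its \<open>l\<close>-th diagonal block, with the rows and columns of that block relabelled
  by \<open>{1..N l}\<close> in the order in which they occur in the permuted matrix.
\<close>

definition diagonal_subpattern ::
    "(nat \<times> nat) set \<Rightarrow> (nat \<Rightarrow> nat) \<Rightarrow> (nat \<Rightarrow> nat) \<Rightarrow> (nat \<Rightarrow> nat) \<Rightarrow> nat \<Rightarrow> (nat \<times> nat) set" where
  "diagonal_subpattern A \<rho> \<kappa> N l =
     {(i, j). i \<in> {1..N l} \<and> j \<in> {1..N l} \<and>
        (\<rho> ((\<Sum>r\<in>{1..<l}. N r) + i), \<kappa> ((\<Sum>r\<in>{1..<l}. N r) + j)) \<in> A}"

definition irreducible_btf ::
    "nat \<Rightarrow> (nat \<times> nat) set \<Rightarrow> (nat \<Rightarrow> nat) \<Rightarrow> (nat \<Rightarrow> nat) \<Rightarrow> nat \<Rightarrow> (nat \<Rightarrow> nat) \<Rightarrow> bool" where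
  "irreducible_btf n A \<rho> \<kappa> p N \<longleftrightarrow> block_triangular_form n A \<rho> \<kappa> p N \<and>
     (\<forall>l\<in>{1..p}. irreducible_pattern (N l) (diagonal_subpattern A \<rho> \<kappa> N l))"

type_synonym block = "nat set \<times> nat set"

definition form_blocks ::
    "(nat \<Rightarrow> nat) \<Rightarrow> (nat \<Rightarrow> nat) \<Rightarrow> nat \<Rightarrow> (nat \<Rightarrow> nat) \<Rightarrow> block set" where
  "form_blocks \<rho> \<kappa> p N = (\<lambda>l. (\<rho> ` index_block N l, \<kappa> ` index_block N l)) ` {1..p}"

text \<open>
  The definite description is well-defined when \<open>A\<close> is a subset of \<open>{1..n} \<times> {1..n}\<close> that contains
  a transversal: an irreducible block-triangular form exists, and all of them have the same blocks.
\<close>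

definition irreducible_emblem :: "nat \<Rightarrow> (nat \<times> nat) set \<Rightarrow> block set" where
  "irreducible_emblem n A =
     (THE E. \<exists>\<rho> \<kappa> p N. irreducible_btf n A \<rho> \<kappa> p N \<and> E = form_blocks \<rho> \<kappa> p N)"

definition fine_blocks :: "nat \<Rightarrow> (nat \<Rightarrow> nat \<Rightarrow> ereal) \<Rightarrow> block set" where
  "fine_blocks n \<sigma> = irreducible_emblem n (essential_pattern n \<sigma>)"

definition coarse_blocks :: "nat \<Rightarrow> (nat \<Rightarrow> nat \<Rightarrow> ereal) \<Rightarrow> block set" where
  "coarse_blocks n \<sigma> = irreducible_emblem n (sparsity_pattern n \<sigma>)"

text \<open>
  The edge relation of the fine-block graph, whose vertex set is \<open>fine_blocks n \<sigma>\<close>. The edges are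
  determined by the full sparsity pattern, not by the essential one.
\<close>

definition fine_block_edges :: "nat \<Rightarrow> (nat \<Rightarrow> nat \<Rightarrow> ereal) \<Rightarrow> (block \<times> block) set" where
  "fine_block_edges n \<sigma> =
     {(b, c). b \<in> fine_blocks n \<sigma> \<and> c \<in> fine_blocks n \<sigma> \<and> b \<noteq> c \<and>
        sparsity_pattern n \<sigma> \<inter> (fst b \<times> snd c) \<noteq> {}}"

definition strong_components :: "'a set \<Rightarrow> ('a \<times> 'a) set \<Rightarrow> 'a set set" where
  "strong_components V E =
     V // {(u, v). u \<in> V \<and> v \<in> V \<and> (u, v) \<in> E\<^sup>* \<and> (v, u) \<in> E\<^sup>*}"

definition block_union :: "block set \<Rightarrow> block" where
  "block_union K = (\<Union>b\<in>K. fst b, \<Union>b\<in>K. snd b)"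

end

theory Submission
  imports Defs "HOL-Library.Disjoint_Sets"
begin

text \<open>
  Let the graph of a bijection \<open>\<tau>\<close> be a transversal contained in a pattern \<open>A\<close>, and join row \<open>i\<close> to
  row \<open>j\<close> whenever \<open>(i, \<tau> j) \<in> A\<close>. The irreducible emblem of \<open>A\<close> consists of the pairs \<open>(R, \<tau> ` R)\<close>
  for the strong components \<open>R\<close> of this digraph: a block-triangular form is a linear arrangement in
  which edges never lead to an earlier block, and it is irreducible iff no block has a proper
  nonempty subset that is closed under edges inside the block. A highest-value transversal lies in
  the essential as well as in the full sparsity pattern, so the same \<open>\<tau>\<close> serves both emblems. The
  fine-block graph is then the digraph of the full pattern, contracted along the strong components
  of the subgraph given by the essential pattern, and contraction along strongly connected sets
  preserves reachability.
\<close>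

section \<open>Index blocks\<close>

lemma index_block_Suc:
  "index_block N (Suc l) = {sum N {1..l}<..sum N {1..l} + N (Suc l)}"
  by (simp add: index_block_def atLeastLessThanSuc_atLeastAtMost)

lemma card_index_block: "1 \<le> l \<Longrightarrow> card (index_block N l) = N l"
  by (cases l) (simp_all add: index_block_Suc)

lemma index_block_eq_image:
  assumes "1 \<le> l"
  shows "index_block N l = (+) (sum N {1..<l}) ` {1..N l}"
proof -
  obtain k where l: "l = Suc k"
    using assms by (cases l) auto
  show ?thesis
    by (auto simp: l index_block_Suc atLeastLessThanSuc_atLeastAtMost image_iff
        intro!: bexI[where x = "_ - sum N {1..k}"])
qed

lemma UN_index_block: "(\<Union>l\<in>{1..p}. index_block N l) = {1..sum N {1..p}}"
proof (induction p)
  case (Suc p)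
  have "{1..Suc p} = insert (Suc p) {1..p}"
    by auto
  then show ?case
    using Suc by (auto simp: index_block_Suc)
qed simp

lemma index_block_less:
  assumes "k < l" "x \<in> index_block N k" "y \<in> index_block N l"
  shows "x < y"
proof -
  have "sum N {1..k} \<le> sum N {1..<l}"
    using assms(1) by (intro sum_mono2) auto
  then show ?thesis
    using assms(2,3) by (auto simp: index_block_def)
qed

lemma index_block_unique:
  "x \<in> index_block N k \<Longrightarrow> x \<in> index_block N l \<Longrightarrow> k = l"
  by (metis index_block_less less_irrefl linorder_neqE_nat)

section \<open>Block forms with prescribed row and column sets\<close>

lemma sum_block_sizes:
  fixes R :: "nat \<Rightarrow> nat set"
  assumes disj: "disjoint_family_on R {1..p}" and un: "(\<Union>l\<in>{1..p}. R l) = {1..n}"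
    and card: "\<And>l. l \<in> {1..p} \<Longrightarrow> card (R l) = N l"
  shows "sum N {1..p} = n"
proof -
  have fin: "finite (R l)" if "l \<in> {1..p}" for l
    by (rule finite_subset[of _ "{1..n}"]) (use un that in auto)
  have "n = card (\<Union>l\<in>{1..p}. R l)"
    unfolding un by simp
  also have "\<dots> = (\<Sum>l\<in>{1..p}. card (R l))"
    using disj fin by (intro card_UN_disjoint) (auto simp: disjoint_family_on_def)
  finally show ?thesis
    using card by simp
qed

text \<open>Index block and target set have the same size, so bijections exist block by block. They
  glue to one permutation because both families partition \<open>{1..n}\<close>.\<close>

lemma exists_permutation_of_blocks:
  assumes disj: "disjoint_family_on R {1..p}" and un: "(\<Union>l\<in>{1..p}. R l) = {1..n}"
    and card: "\<And>l. l \<in> {1..p} \<Longrightarrow> card (R l) = N l"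
  shows "\<exists>\<rho>. \<rho> permutes {1..n} \<and> (\<forall>l\<in>{1..p}. \<rho> ` index_block N l = R l)"
proof -
  have finR: "finite (R l)" if "l \<in> {1..p}" for l
    by (rule finite_subset[of _ "{1..n}"]) (use un that in auto)
  have n: "n = sum N {1..p}"
    using sum_block_sizes[OF disj un card] by simp
  have "\<exists>b. bij_betw b (index_block N l) (R l)" if "l \<in> {1..p}" for l
    using that finR[OF that] card[OF that]
    by (intro finite_same_card_bij) (auto simp: card_index_block, simp add: index_block_def)
  then obtain b where b: "\<And>l. l \<in> {1..p} \<Longrightarrow> bij_betw (b l) (index_block N l) (R l)"
    by metis
  define ix where "ix x = (SOME l. l \<in> {1..p} \<and> x \<in> index_block N l)" for x
  \<comment> \<open>\<open>permutes\<close> demands the identity outside \<open>{1..n}\<close>.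
    Inside, \<open>ix x\<close> is the only block containing \<open>x\<close>, by disjointness of
    the index blocks.\<close>
  define \<rho> where "\<rho> x = (if x \<in> {1..n} then b (ix x) x else x)" for x
  have blk: "index_block N l \<subseteq> {1..n}" if "l \<in> {1..p}" for l
    using UN_index_block[where N=N and p=p] that n by auto
  have ix: "ix x = l" if "l \<in> {1..p}" "x \<in> index_block N l" for x l
    unfolding ix_def using that by (intro some_equality) (auto dest: index_block_unique)
  have bl: "bij_betw \<rho> (index_block N l) (R l)" if "l \<in> {1..p}" for l
    using b[OF that] by (rule bij_betw_cong[THEN iffD1, rotated])
      (use blk[OF that] ix[OF that] in \<open>auto simp: \<rho>_def\<close>)
  have "bij_betw \<rho> (\<Union>l\<in>{1..p}. index_block N l) (\<Union>l\<in>{1..p}. R l)"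
    using disj bl by (rule bij_betw_UNION_disjoint)
  then have "bij_betw \<rho> {1..n} {1..n}"
    unfolding UN_index_block un n[symmetric] .
  then have "\<rho> permutes {1..n}"
    by (rule bij_imp_permutes) (auto simp: \<rho>_def)
  then show ?thesis
    using bl unfolding bij_betw_def by blast
qed

text \<open>The source of every block form constructed below: a two-block form that isolates a set
  without outgoing edges, and the form whose blocks are the strong components.\<close>

lemma exists_square_block_form:
  assumes "disjoint_family_on R {1..p}" "(\<Union>l\<in>{1..p}. R l) = {1..n}"
    and "disjoint_family_on C {1..p}" "(\<Union>l\<in>{1..p}. C l) = {1..n}"
    and "\<And>l. l \<in> {1..p} \<Longrightarrow> R l \<noteq> {}" "\<And>l. l \<in> {1..p} \<Longrightarrow> card (C l) = card (R l)"
  shows "\<exists>\<rho> \<kappa> N. square_block_form n \<rho> \<kappa> p N \<and>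
    (\<forall>l\<in>{1..p}. \<rho> ` index_block N l = R l \<and> \<kappa> ` index_block N l = C l)"
proof -
  define N where "N l = card (R l)" for l
  obtain \<rho> where \<rho>: "\<rho> permutes {1..n}" "\<forall>l\<in>{1..p}. \<rho> ` index_block N l = R l"
    using exists_permutation_of_blocks[OF assms(1,2), of N] by (auto simp: N_def)
  obtain \<kappa> where \<kappa>: "\<kappa> permutes {1..n}" "\<forall>l\<in>{1..p}. \<kappa> ` index_block N l = C l"
    using exists_permutation_of_blocks[OF assms(3,4), of N] assms(6) by (auto simp: N_def)
  have fin: "finite (R l)" if "l \<in> {1..p}" for l
    by (rule finite_subset[of _ "{1..n}"]) (use assms(2) that in auto)
  have "sum N {1..p} = n"
    using assms(1,2) by (rule sum_block_sizes) (simp add: N_def)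
  then have "square_block_form n \<rho> \<kappa> p N"
    using \<rho>(1) \<kappa>(1) assms(5) fin by (auto simp: square_block_form_def N_def card_gt_0_iff)
  then show ?thesis
    using \<rho>(2) \<kappa>(2) by blast
qed

lemma square_block_formD:
  assumes "square_block_form n \<rho> \<kappa> p N"
  shows "bij_betw \<rho> {1..n} {1..n}" "bij_betw \<kappa> {1..n} {1..n}"
    and "(\<Union>l\<in>{1..p}. index_block N l) = {1..n}"
    and "l \<in> {1..p} \<Longrightarrow> index_block N l \<subseteq> {1..n}"
    and "l \<in> {1..p} \<Longrightarrow> index_block N l \<noteq> {}"
proof -
  show "bij_betw \<rho> {1..n} {1..n}" "bij_betw \<kappa> {1..n} {1..n}"
    using assms by (auto simp: square_block_form_def permutes_imp_bij)
  show un: "(\<Union>l\<in>{1..p}. index_block N l) = {1..n}"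
    using assms UN_index_block[where N = N and p = p] unfolding square_block_form_def by metis
  show "l \<in> {1..p} \<Longrightarrow> index_block N l \<subseteq> {1..n}"
    using un by blast
  show "index_block N l \<noteq> {}" if "l \<in> {1..p}"
  proof
    assume "index_block N l = {}"
    then have "N l = 0"
      using card_index_block[of l N] that by simp
    then show False
      using assms that unfolding square_block_form_def by (metis less_irrefl)
  qed
qed

lemma row_block_unique:
  assumes "square_block_form n \<rho> \<kappa> p N" "k \<in> {1..p}" "l \<in> {1..p}"
    and "i \<in> \<rho> ` index_block N k" "i \<in> \<rho> ` index_block N l"
  shows "k = l"
proof -
  obtain x y where xy: "x \<in> index_block N k" "y \<in> index_block N l" "\<rho> x = i" "\<rho> y = i"
    using assms(4,5) by (metis imageE)
  have "x = y"
    using square_block_formD[OF assms(1)] assms(2,3) xy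
    by (metis bij_betw_imp_inj_on inj_onD subsetD)
  then show ?thesis
    using xy index_block_unique by blast
qed

lemma UN_row_blocks:
  assumes "square_block_form n \<rho> \<kappa> p N"
  shows "(\<Union>l\<in>{1..p}. \<rho> ` index_block N l) = {1..n}"
  using square_block_formD(1,3)[OF assms] by (metis bij_betw_imp_surj_on image_UN)

text \<open>Lets facts about row blocks be applied to column blocks.\<close>

lemma square_block_form_swap:
  "square_block_form n \<rho> \<kappa> p N \<Longrightarrow> square_block_form n \<kappa> \<rho> p N"
  by (auto simp: square_block_form_def)

section \<open>Transversals and block-triangular forms\<close>

lemma transversal_graph:
  assumes "bij_betw \<tau> {1..n} {1..n}"
  shows "transversal n {(i, \<tau> i) | i. i \<in> {1..n}}"
proof -
  have "\<exists>!i. i \<in> {1..n} \<and> \<tau> i = j" if "j \<in> {1..n}" for j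
    using assms that unfolding bij_betw_def inj_on_def by (metis (full_types) imageE)
  moreover have "\<tau> i \<in> {1..n}" if "i \<in> {1..n}" for i
    using assms that by (rule bij_betwE[rule_format])
  ultimately show ?thesis
    unfolding transversal_def by auto metis+
qed

lemma transversal_eq_graph:
  assumes "transversal n T"
  obtains \<tau> where "bij_betw \<tau> {1..n} {1..n}" "T = {(i, \<tau> i) | i. i \<in> {1..n}}"
proof -
  have T: "T \<subseteq> {1..n} \<times> {1..n}" "\<And>i. i \<in> {1..n} \<Longrightarrow> \<exists>!j. (i, j) \<in> T"
    "\<And>j. j \<in> {1..n} \<Longrightarrow> \<exists>!i. (i, j) \<in> T"
    using assms unfolding transversal_def by auto
  define \<tau> where "\<tau> i = (THE j. (i, j) \<in> T)" for i
  have \<tau>: "(i, \<tau> i) \<in> T" if "i \<in> {1..n}" for i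
    unfolding \<tau>_def using T(2)[OF that] by (rule theI')
  have \<tau>_eq: "\<tau> i = j" if "(i, j) \<in> T" for i j
    using T(1,2) \<tau> that by blast
  have "inj_on \<tau> {1..n}"
    by (rule inj_onI) (metis T(1,3) \<tau> mem_Sigma_iff subsetD)
  moreover have "\<tau> ` {1..n} = {1..n}"
    using T(1,3) \<tau> \<tau>_eq by (auto simp: image_iff) (metis SigmaD2 atLeastAtMost_iff subsetD One_nat_def,
      metis SigmaD2 atLeastAtMost_iff subsetD, metis SigmaD1 atLeastAtMost_iff subsetD One_nat_def)
  ultimately have "bij_betw \<tau> {1..n} {1..n}"
    by (simp add: bij_betw_def)
  moreover have "T = {(i, \<tau> i) | i. i \<in> {1..n}}"
    using T(1) \<tau> \<tau>_eq by auto
  ultimately show ?thesis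
    by (rule that)
qed

text \<open>
  A transversal maps the last rows of a block-triangular form into the last columns, hence onto
  them by counting. Differences of these tails give the blocks.
\<close>

lemma btf_transversal_image:
  assumes btf: "block_triangular_form n A \<rho> \<kappa> p N"
    and \<tau>: "bij_betw \<tau> {1..n} {1..n}" "\<And>i. i \<in> {1..n} \<Longrightarrow> (i, \<tau> i) \<in> A"
    and l: "l \<in> {1..p}"
  shows "\<tau> ` \<rho> ` index_block N l = \<kappa> ` index_block N l"
proof -
  have sq: "square_block_form n \<rho> \<kappa> p N"
    and zero: "\<And>k l. k \<in> {1..p} \<Longrightarrow> l \<in> {1..p} \<Longrightarrow> k > l \<Longrightarrow>
      A \<inter> (\<rho> ` index_block N k \<times> \<kappa> ` index_block N l) = {}"
    using btf by (auto simp: block_triangular_form_def)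
  note sqD = square_block_formD[OF sq]
  define U where "U k = (\<Union>l\<in>{k..p}. index_block N l)" for k
  have U_sub: "U k \<subseteq> {1..n}" if "1 \<le> k" for k
    using sqD(3) that by (auto simp: U_def)
  have inj: "inj_on (\<lambda>x. \<tau> (\<rho> x)) {1..n}"
    using bij_betw_trans[OF sqD(1) \<tau>(1)] by (auto simp: bij_betw_def o_def)
  have inj\<kappa>: "inj_on \<kappa> {1..n}"
    using sqD(2) by (simp add: bij_betw_def)
  have tail: "(\<lambda>x. \<tau> (\<rho> x)) ` U k = \<kappa> ` U k" if k: "1 \<le> k" for k
  proof (rule card_subset_eq)
    show "finite (\<kappa> ` U k)"
      using U_sub[OF k] finite_subset by blast
    show "card ((\<lambda>x. \<tau> (\<rho> x)) ` U k) = card (\<kappa> ` U k)"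
      using U_sub[OF k] inj inj\<kappa> by (metis card_image inj_on_subset)
    show "(\<lambda>x. \<tau> (\<rho> x)) ` U k \<subseteq> \<kappa> ` U k"
    proof (rule image_subsetI)
      fix x assume "x \<in> U k"
      then obtain a where a: "a \<in> {k..p}" "x \<in> index_block N a"
        by (auto simp: U_def)
      then have "x \<in> {1..n}"
        using sqD(3) k by fastforce
      then have \<rho>x: "\<rho> x \<in> {1..n}"
        using sqD(1) by (simp only: bij_betw_apply)
      then have "\<tau> (\<rho> x) \<in> {1..n}"
        using \<tau>(1) by (simp only: bij_betw_apply)
      then obtain b where b: "b \<in> {1..p}" "\<tau> (\<rho> x) \<in> \<kappa> ` index_block N b"
        using UN_row_blocks[OF square_block_form_swap[OF sq]] by blast
      \<comment> \<open>The position of the transversal in row \<open>\<rho> x\<close> belongs to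
        \<open>A\<close>, so it cannot lie below the block diagonal.\<close>
      have "\<not> b < a"
        using zero[of a b] a b k \<tau>(2)[OF \<rho>x] by auto
      then have "b \<in> {k..p}"
        using a b by auto
      then show "\<tau> (\<rho> x) \<in> \<kappa> ` U k"
        using b(2) unfolding U_def by blast
    qed
  qed
  \<comment> \<open>For \<open>l = p\<close> the tail \<open>U (Suc l)\<close> is empty, so the last
    block needs no separate case.\<close>
  have "{l..p} = insert l {Suc l..p}"
    using l by auto
  then have U_split: "U l = U (Suc l) \<union> index_block N l"
    by (auto simp: U_def)
  have "index_block N l \<inter> U (Suc l) = {}"
    by (auto simp: U_def dest: index_block_unique)
  then have diff: "index_block N l = U l - U (Suc l)"
    using U_split by auto
  have l1: "1 \<le> l" "1 \<le> Suc l"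
    using l by auto
  have sub: "U l \<subseteq> {1..n}" "U (Suc l) \<subseteq> {1..n}"
    using U_sub l1 by blast+
  have "(\<lambda>x. \<tau> (\<rho> x)) ` index_block N l = \<kappa> ` index_block N l"
    unfolding diff using sub inj_on_image_set_diff[OF inj, of "U l" "U (Suc l)"]
      inj_on_image_set_diff[OF inj\<kappa>, of "U l" "U (Suc l)"] tail[OF l1(1)] tail[OF l1(2)]
    by (metis Diff_subset subset_trans)
  then show ?thesis
    by (simp add: image_image)
qed

section \<open>The digraph of a transversal and indecomposable row sets\<close>

text \<open>Naming each column by the row that \<open>\<tau>\<close> matches with it moves the
  transversal to the diagonal; this is then the usual digraph of a square pattern, with the
  transversal giving the loops.\<close>

definition transversal_graph_edges ::
    "nat \<Rightarrow> (nat \<times> nat) set \<Rightarrow> (nat \<Rightarrow> nat) \<Rightarrow> (nat \<times> nat) set" where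
  "transversal_graph_edges n A \<tau> = {(i, j). i \<in> {1..n} \<and> j \<in> {1..n} \<and> (i, \<tau> j) \<in> A}"

text \<open>Strong connectedness of the digraph induced on \<open>R\<close>, expressed through cuts
  rather than paths. A cut without outgoing edges is exactly a zero block, which makes the
  comparison with block-triangular forms direct.\<close>

definition indecomposable :: "(nat \<times> nat) set \<Rightarrow> (nat \<Rightarrow> nat) \<Rightarrow> nat set \<Rightarrow> bool" where
  "indecomposable A \<tau> R \<longleftrightarrow> (\<forall>X. X \<subset> R \<longrightarrow> X \<noteq> {} \<longrightarrow> (\<exists>i\<in>X. \<exists>j\<in>R - X. (i, \<tau> j) \<in> A))"

lemma indecomposableD:
  "indecomposable A \<tau> R \<Longrightarrow> X \<subset> R \<Longrightarrow> X \<noteq> {} \<Longrightarrow> \<exists>i\<in>X. \<exists>j\<in>R - X. (i, \<tau> j) \<in> A"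
  by (simp add: indecomposable_def)

text \<open>In a block-triangular form, rows outside the first block have no entry in the columns of
  the first block, and these columns are the images of its rows under the bijection
  \<open>\<sigma>\<close>. With \<open>p > 1\<close>, the complement of the first row block is thus
  a proper nonempty set without outgoing edges.\<close>

lemma indecomposable_imp_irreducible_pattern:
  assumes \<sigma>: "bij_betw \<sigma> {1..m} {1..m}" "\<And>i. i \<in> {1..m} \<Longrightarrow> (i, \<sigma> i) \<in> D"
    and ind: "indecomposable D \<sigma> {1..m}"
  shows "irreducible_pattern m D"
proof -
  have "False" if p: "p > 1" and btf: "block_triangular_form m D \<rho> \<kappa> p N" for \<rho> \<kappa> p N
  proof -
    have sq: "square_block_form m \<rho> \<kappa> p N"
      and zero: "\<And>k l. k \<in> {1..p} \<Longrightarrow> l \<in> {1..p} \<Longrightarrow> k > l \<Longrightarrow>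
        D \<inter> (\<rho> ` index_block N k \<times> \<kappa> ` index_block N l) = {}"
      using btf by (auto simp: block_triangular_form_def)
    have one: "1 \<in> {1..p}" "2 \<in> {1..p}"
      using p by auto
    define X where "X = {1..m} - \<rho> ` index_block N 1"
    have "X \<noteq> {}"
    proof -
      obtain x where x: "x \<in> \<rho> ` index_block N 2"
        using square_block_formD(5)[OF sq one(2)] by blast
      then have "x \<in> {1..m}"
        using UN_row_blocks[OF sq] one by blast
      then have "x \<in> X"
        using x row_block_unique[OF sq one] by (auto simp: X_def)
      then show ?thesis
        by blast
    qed
    moreover have B1: "\<rho> ` index_block N 1 \<subseteq> {1..m}"
      using UN_row_blocks[OF sq] one by blast
    moreover have "\<rho> ` index_block N 1 \<noteq> {}"
      using square_block_formD(5)[OF sq one(1)] by blast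
    ultimately have "X \<subset> {1..m}" "X \<noteq> {}"
      by (auto simp: X_def)
    then obtain i j where ij: "i \<in> X" "j \<in> {1..m} - X" "(i, \<sigma> j) \<in> D"
      using ind unfolding indecomposable_def by blast
    have "j \<in> \<rho> ` index_block N 1"
      using ij by (auto simp: X_def)
    then have col: "\<sigma> j \<in> \<kappa> ` index_block N 1"
      using btf_transversal_image[OF btf \<sigma> one(1)] by blast
    have "i \<in> {1..m}"
      using ij(1) by (simp add: X_def)
    then obtain k where k: "k \<in> {1..p}" "i \<in> \<rho> ` index_block N k"
      using UN_row_blocks[OF sq] by blast
    then have "k \<noteq> 1"
      using ij(1) by (auto simp: X_def)
    then show False
      using zero[OF k(1) one(1)] k col ij(3) by auto
  qed
  moreover have "{(i, \<sigma> i) | i. i \<in> {1..m}} \<subseteq> D"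
    using \<sigma>(2) by blast
  ultimately show ?thesis
    unfolding irreducible_pattern_def using transversal_graph[OF \<sigma>(1)] by blast
qed

text \<open>A proper nonempty \<open>X\<close> that no edge leaves can be placed last: its rows have
  no entries in the columns matched with the complement, which gives a block-triangular form with
  two blocks.\<close>

lemma irreducible_pattern_imp_indecomposable:
  assumes \<sigma>: "bij_betw \<sigma> {1..m} {1..m}" and irr: "irreducible_pattern m D"
  shows "indecomposable D \<sigma> {1..m}"
  unfolding indecomposable_def
proof (intro allI impI)
  fix X assume X: "X \<subset> {1..m}" "X \<noteq> {}"
  show "\<exists>i\<in>X. \<exists>j\<in>{1..m} - X. (i, \<sigma> j) \<in> D"
  proof (rule ccontr)
    assume no: "\<not> ?thesis"
    have inj: "inj_on \<sigma> {1..m}" and sur: "\<sigma> ` {1..m} = {1..m}"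
      using \<sigma> by (auto simp: bij_betw_def)
    define R where "R l = (if l = (1::nat) then {1..m} - X else X)" for l
    have two: "{1..2::nat} = {1, 2}"
      by auto
    have R_sub: "R l \<subseteq> {1..m}" for l
      using X by (auto simp: R_def)
    have disj: "disjoint_family_on R {1..2}"
      by (auto simp: disjoint_family_on_def R_def)
    have un: "(\<Union>l\<in>{1..2}. R l) = {1..m}"
      using X unfolding two by (auto simp: R_def)
    have "disjoint_family_on (\<lambda>l. \<sigma> ` R l) {1..2}"
      unfolding disjoint_family_on_def
      using disj inj_on_image_Int[OF inj R_sub R_sub, symmetric] by (auto simp: disjoint_family_on_def)
    moreover have "(\<Union>l\<in>{1..2}. \<sigma> ` R l) = {1..m}"
      using un sur by (metis image_UN)
    moreover have "R l \<noteq> {}" for l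
      using X by (auto simp: R_def)
    moreover have "card (\<sigma> ` R l) = card (R l)" for l
      using inj R_sub by (metis card_image inj_on_subset)
    ultimately obtain \<rho> \<kappa> N where sq: "square_block_form m \<rho> \<kappa> 2 N"
      and bl: "\<forall>l\<in>{1..2}. \<rho> ` index_block N l = R l \<and> \<kappa> ` index_block N l = \<sigma> ` R l"
      using exists_square_block_form[OF disj un, of "\<lambda>l. \<sigma> ` R l"] by blast
    have "D \<inter> (R 2 \<times> \<sigma> ` R 1) = {}"
      using no by (auto simp: R_def)
    then have "block_triangular_form m D \<rho> \<kappa> 2 N"
      unfolding block_triangular_form_def two using sq bl by (auto simp: two)
    then have "\<exists>\<rho> \<kappa> p N. p > 1 \<and> block_triangular_form m D \<rho> \<kappa> p N"
      by (intro exI[of _ \<rho>] exI[of _ \<kappa>] exI[of _ 2] exI[of _ N]) simp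
    then show False
      using irr unfolding irreducible_pattern_def by blast
  qed
qed

text \<open>The assumption on \<open>h\<close> says that the row relabelling \<open>g\<close> and
  the column relabelling \<open>h\<close> carry one transversal to the other. Hence \<open>g\<close>
  is an isomorphism of the two induced digraphs: \<open>(g a, h (\<sigma> b))\<close> is
  \<open>(g a, \<tau> (g b))\<close>.\<close>

lemma indecomposable_relabel:
  assumes g: "bij_betw g M R" and h: "\<And>a. a \<in> M \<Longrightarrow> h (\<sigma> a) = \<tau> (g a)"
    and \<sigma>: "\<And>a. a \<in> M \<Longrightarrow> \<sigma> a \<in> M"
  shows "indecomposable {(a, b). a \<in> M \<and> b \<in> M \<and> (g a, h b) \<in> A} \<sigma> M \<longleftrightarrow> indecomposable A \<tau> R"
proof
  have inj: "inj_on g M" and img: "g ` M = R"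
    using g by (auto simp: bij_betw_def)
  let ?D = "{(a, b). a \<in> M \<and> b \<in> M \<and> (g a, h b) \<in> A}"
  show "indecomposable A \<tau> R" if ind: "indecomposable ?D \<sigma> M"
    unfolding indecomposable_def
  proof (intro allI impI)
    fix X assume X: "X \<subset> R" "X \<noteq> {}"
    define Y where "Y = {a \<in> M. g a \<in> X}"
    have "Y \<subset> M" "Y \<noteq> {}"
      using X img by (auto simp: Y_def)
    then obtain a b where "a \<in> Y" "b \<in> M - Y" "(a, \<sigma> b) \<in> ?D"
      using ind unfolding indecomposable_def by blast
    then have "g a \<in> X" "g b \<in> R - X" "(g a, \<tau> (g b)) \<in> A"
      using img h by (auto simp: Y_def)
    then show "\<exists>i\<in>X. \<exists>j\<in>R - X. (i, \<tau> j) \<in> A"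
      by blast
  qed
  show "indecomposable ?D \<sigma> M" if ind: "indecomposable A \<tau> R"
    unfolding indecomposable_def
  proof (intro allI impI)
    fix Y assume Y: "Y \<subset> M" "Y \<noteq> {}"
    have "g ` Y \<subset> R" "g ` Y \<noteq> {}"
      using Y g by (auto simp: bij_betw_def inj_on_image_eq_iff psubset_eq)
    from indecomposableD[OF ind this] obtain a b where
      ab: "a \<in> Y" "b \<in> M - Y" "(g a, \<tau> (g b)) \<in> A"
      using img by blast
    then have "(a, \<sigma> b) \<in> ?D"
      using Y h \<sigma> by auto
    then show "\<exists>a\<in>Y. \<exists>b\<in>M - Y. (a, \<sigma> b) \<in> ?D"
      using ab by blast
  qed
qed

text \<open>Removes the local labels \<open>{1..N l}\<close>. Since \<open>\<tau>\<close> maps the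
  row block onto the column block, it induces a transversal of the relabelled diagonal block, and
  the previous lemmas apply.\<close>

lemma irreducible_diagonal_iff:
  assumes btf: "block_triangular_form n A \<rho> \<kappa> p N"
    and \<tau>: "bij_betw \<tau> {1..n} {1..n}" "\<And>i. i \<in> {1..n} \<Longrightarrow> (i, \<tau> i) \<in> A"
    and l: "l \<in> {1..p}"
  shows "irreducible_pattern (N l) (diagonal_subpattern A \<rho> \<kappa> N l) \<longleftrightarrow>
    indecomposable A \<tau> (\<rho> ` index_block N l)"
proof -
  have sq: "square_block_form n \<rho> \<kappa> p N"
    using btf by (simp add: block_triangular_form_def)
  note sqD = square_block_formD[OF sq]
  define s where "s = sum N {1..<l}"
  define g h where "g = \<rho> \<circ> (+) s" and "h = \<kappa> \<circ> (+) s"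
  let ?M = "{1..N l}" and ?R = "\<rho> ` index_block N l" and ?C = "\<kappa> ` index_block N l"
  have shift: "bij_betw ((+) s) ?M (index_block N l)"
    using l by (auto simp: bij_betw_def s_def index_block_eq_image)
  have "bij_betw \<rho> (index_block N l) ?R" "bij_betw \<kappa> (index_block N l) ?C"
    using sqD(1,2) sqD(4)[OF l] by (auto intro: bij_betw_subset)
  then have g: "bij_betw g ?M ?R" and h: "bij_betw h ?M ?C"
    unfolding g_def h_def using shift by (blast intro: bij_betw_trans)+
  have R_sub: "?R \<subseteq> {1..n}"
    using UN_row_blocks[OF sq] l by blast
  have "bij_betw \<tau> ?R ?C"
    using \<tau>(1) R_sub btf_transversal_image[OF btf \<tau> l] by (rule bij_betw_subset)
  \<comment> \<open>\<open>\<tau>\<close> in local labels: from local to global row by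
    \<open>g\<close>, along \<open>\<tau>\<close> to a global column, back to a local column by the
    inverse of \<open>h\<close>.\<close>
  define \<sigma> where "\<sigma> = the_inv_into ?M h \<circ> (\<tau> \<circ> g)"
  have \<tau>g: "bij_betw (\<tau> \<circ> g) ?M ?C"
    using g \<open>bij_betw \<tau> ?R ?C\<close> by (rule bij_betw_trans)
  have \<sigma>: "bij_betw \<sigma> ?M ?M"
    unfolding \<sigma>_def using \<tau>g bij_betw_the_inv_into[OF h] by (rule bij_betw_trans)
  have h\<sigma>: "h (\<sigma> a) = \<tau> (g a)" if "a \<in> ?M" for a
  proof -
    have "\<tau> (g a) \<in> h ` ?M"
      using bij_betw_apply[OF \<tau>g that] h by (simp add: bij_betw_def)
    then show ?thesis
      using h by (simp add: \<sigma>_def f_the_inv_into_f bij_betw_def)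
  qed
  have D: "diagonal_subpattern A \<rho> \<kappa> N l = {(a, b). a \<in> ?M \<and> b \<in> ?M \<and> (g a, h b) \<in> A}"
    by (simp add: diagonal_subpattern_def g_def h_def s_def)
  have "(a, \<sigma> a) \<in> diagonal_subpattern A \<rho> \<kappa> N l" if a: "a \<in> ?M" for a
  proof -
    have "g a \<in> {1..n}"
      using bij_betw_apply[OF g a] R_sub by blast
    then show ?thesis
      unfolding D using a bij_betw_apply[OF \<sigma> a] h\<sigma>[OF a] \<tau>(2) by simp
  qed
  then have "irreducible_pattern (N l) (diagonal_subpattern A \<rho> \<kappa> N l) \<longleftrightarrow>
    indecomposable (diagonal_subpattern A \<rho> \<kappa> N l) \<sigma> ?M"
    using \<sigma> indecomposable_imp_irreducible_pattern irreducible_pattern_imp_indecomposable by blast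
  also have "\<dots> \<longleftrightarrow> indecomposable A \<tau> ?R"
    unfolding D using g h\<sigma> bij_betw_apply[OF \<sigma>] by (rule indecomposable_relabel)
  finally show ?thesis .
qed

section \<open>The emblem as the set of strong components\<close>

definition mutually_reachable :: "'a set \<Rightarrow> ('a \<times> 'a) set \<Rightarrow> ('a \<times> 'a) set" where
  "mutually_reachable V E = {(u, v). u \<in> V \<and> v \<in> V \<and> (u, v) \<in> E\<^sup>* \<and> (v, u) \<in> E\<^sup>*}"

lemma strong_components_eq: "strong_components V E = V // mutually_reachable V E"
  by (simp add: strong_components_def mutually_reachable_def)

lemma equiv_mutually_reachable: "equiv V (mutually_reachable V E)"
  by (rule equivI) (auto simp: mutually_reachable_def refl_on_def sym_def trans_def
      intro: rtrancl_trans)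

lemma mem_mutually_reachable_Image:
  "v \<in> mutually_reachable V E `` {u} \<longleftrightarrow> u \<in> V \<and> v \<in> V \<and> (u, v) \<in> E\<^sup>* \<and> (v, u) \<in> E\<^sup>*"
  by (simp add: mutually_reachable_def)

lemma mutually_reachable_Image_eq_iff:
  assumes "u \<in> V" "v \<in> V"
  shows "mutually_reachable V E `` {u} = mutually_reachable V E `` {v} \<longleftrightarrow>
    (u, v) \<in> E\<^sup>* \<and> (v, u) \<in> E\<^sup>*"
  using eq_equiv_class_iff[OF equiv_mutually_reachable assms] assms
  by (auto simp: mutually_reachable_def)

lemma strong_component_eq_Image:
  assumes "R \<in> strong_components V E" "u \<in> R"
  shows "R = mutually_reachable V E `` {u}"
proof -
  obtain v where v: "R = mutually_reachable V E `` {v}"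
    using assms(1) unfolding strong_components_eq by (rule quotientE)
  then have "(v, u) \<in> mutually_reachable V E"
    using assms(2) by simp
  then show ?thesis
    unfolding v by (rule equiv_class_eq[OF equiv_mutually_reachable])
qed

text \<open>Take \<open>x\<close> in \<open>X\<close> and \<open>y\<close> in \<open>R\<close>
  outside \<open>X\<close>. A path from \<open>x\<close> to \<open>y\<close> stays in
  \<open>R\<close>, since its vertices lie between two vertices of one component; if no edge led
  from \<open>X\<close> to \<open>R - X\<close>, the path could never leave
  \<open>X\<close>.\<close>

lemma indecomposable_strong_component:
  assumes "R \<in> strong_components {1..n} (transversal_graph_edges n A \<tau>)"
  shows "indecomposable A \<tau> R"
  unfolding indecomposable_def
proof (intro allI impI)
  fix X assume X: "X \<subset> R" "X \<noteq> {}"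
  define G where "G = transversal_graph_edges n A \<tau>"
  obtain u where u: "u \<in> {1..n}" "R = mutually_reachable {1..n} G `` {u}"
    using assms unfolding strong_components_eq G_def by (auto elim: quotientE)
  obtain x y where xy: "x \<in> X" "y \<in> R" "y \<notin> X" "x \<in> R"
    using X by blast
  have memR: "z \<in> R \<longleftrightarrow> z \<in> {1..n} \<and> (u, z) \<in> G\<^sup>* \<and> (z, u) \<in> G\<^sup>*" for z
    unfolding u(2) mem_mutually_reachable_Image using u(1) by simp
  show "\<exists>i\<in>X. \<exists>j\<in>R - X. (i, \<tau> j) \<in> A"
  proof (rule ccontr)
    assume no: "\<not> ?thesis"
    \<comment> \<open>The premise that \<open>z\<close> still reaches \<open>y\<close> keeps
      \<open>z\<close> inside \<open>R\<close>; an arbitrary path from \<open>x\<close> may leave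
      the component.\<close>
    have "(z, y) \<in> G\<^sup>* \<longrightarrow> z \<in> X" if "(x, z) \<in> G\<^sup>*" for z
      using that
    proof (induction rule: rtrancl_induct)
      case (step z w)
      show ?case
      proof
        assume w: "(w, y) \<in> G\<^sup>*"
        have "z \<in> X"
          using step w by (meson converse_rtrancl_into_rtrancl)
        have "w \<in> {1..n}" "(z, \<tau> w) \<in> A"
          using step(2) by (auto simp: G_def transversal_graph_edges_def)
        moreover have "(u, w) \<in> G\<^sup>*" "(w, u) \<in> G\<^sup>*"
          using step(1,2) w xy memR by (meson rtrancl.rtrancl_into_rtrancl rtrancl_trans)+
        ultimately show "w \<in> X"
          using no \<open>z \<in> X\<close> memR by blast
      qed
    qed (use xy in simp)
    then show False
      using xy memR by (meson rtrancl.rtrancl_refl rtrancl_trans)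
  qed
qed

section \<open>Strong components as blocks of irreducible forms\<close>

text \<open>An edge from \<open>j\<close> to \<open>j'\<close> is an entry in row \<open>j\<close>
  and column \<open>\<tau> j'\<close>, and that column lies in the column block of the same index as
  the row block of \<open>j'\<close>. Triangularity forbids a smaller index.\<close>

lemma btf_path_increases:
  assumes btf: "block_triangular_form n A \<rho> \<kappa> p N"
    and \<tau>: "bij_betw \<tau> {1..n} {1..n}" "\<And>i. i \<in> {1..n} \<Longrightarrow> (i, \<tau> i) \<in> A"
    and path: "(i, j) \<in> (transversal_graph_edges n A \<tau>)\<^sup>*"
    and k: "k \<in> {1..p}" "i \<in> \<rho> ` index_block N k"
  shows "\<exists>l\<in>{k..p}. j \<in> \<rho> ` index_block N l"
  using path
proof (induction rule: rtrancl_induct)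
  case base
  then show ?case
    using k by auto
next
  case (step j j')
  have sq: "square_block_form n \<rho> \<kappa> p N"
    using btf by (simp add: block_triangular_form_def)
  obtain l where l: "l \<in> {k..p}" "j \<in> \<rho> ` index_block N l"
    using step by blast
  have j': "j' \<in> {1..n}" "(j, \<tau> j') \<in> A"
    using step(2) by (auto simp: transversal_graph_edges_def)
  then obtain l' where l': "l' \<in> {1..p}" "j' \<in> \<rho> ` index_block N l'"
    using UN_row_blocks[OF sq] by blast
  then have "\<tau> j' \<in> \<kappa> ` index_block N l'"
    using btf_transversal_image[OF btf \<tau> l'(1)] by blast
  moreover have "l \<in> {1..p}"
    using l k by auto
  ultimately have "\<not> l' < l"
    using btf l l' j' unfolding block_triangular_form_def by blast
  then show ?case
    using l l' by auto
qed

text \<open>Indecomposability connects any two rows of the block. Conversely, a path out of the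
  block and back would have to decrease the block index somewhere.\<close>

lemma row_block_strong_component:
  assumes btf: "block_triangular_form n A \<rho> \<kappa> p N"
    and \<tau>: "bij_betw \<tau> {1..n} {1..n}" "\<And>i. i \<in> {1..n} \<Longrightarrow> (i, \<tau> i) \<in> A"
    and ind: "indecomposable A \<tau> (\<rho> ` index_block N l)"
    and l: "l \<in> {1..p}" "i \<in> \<rho> ` index_block N l"
  shows "\<rho> ` index_block N l =
    mutually_reachable {1..n} (transversal_graph_edges n A \<tau>) `` {i}"
proof -
  define G where "G = transversal_graph_edges n A \<tau>"
  let ?R = "\<rho> ` index_block N l"
  have sq: "square_block_form n \<rho> \<kappa> p N"
    using btf by (simp add: block_triangular_form_def)
  have R_sub: "?R \<subseteq> {1..n}"
    using UN_row_blocks[OF sq] l by blast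
  have reach: "(a, b) \<in> G\<^sup>*" if ab: "a \<in> ?R" "b \<in> ?R" for a b
  proof (rule ccontr)
    assume "(a, b) \<notin> G\<^sup>*"
    \<comment> \<open>The rows of the block reachable from \<open>a\<close> contain \<open>a\<close>
      but not \<open>b\<close>, and no edge inside the block leaves this set: a forbidden
      cut.\<close>
    then have "G\<^sup>* `` {a} \<inter> ?R \<subset> ?R" "G\<^sup>* `` {a} \<inter> ?R \<noteq> {}"
      using ab by auto
    from indecomposableD[OF ind this] obtain x y where
      xy: "x \<in> G\<^sup>* `` {a} \<inter> ?R" "y \<in> ?R - (G\<^sup>* `` {a} \<inter> ?R)" "(x, \<tau> y) \<in> A"
      by (elim bexE)
    then have "(x, y) \<in> G"
      using R_sub by (auto simp: G_def transversal_graph_edges_def)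
    then show False
      using xy by (auto intro: rtrancl.rtrancl_into_rtrancl)
  qed
  have "j \<in> ?R" if j: "j \<in> {1..n}" "(i, j) \<in> G\<^sup>*" "(j, i) \<in> G\<^sup>*" for j
  proof -
    obtain k where k: "k \<in> {l..p}" "j \<in> \<rho> ` index_block N k"
      using btf_path_increases[OF btf \<tau> j(2)[unfolded G_def] l] by blast
    have k1: "k \<in> {1..p}"
      using k l by auto
    obtain l' where l': "l' \<in> {k..p}" "i \<in> \<rho> ` index_block N l'"
      using btf_path_increases[OF btf \<tau> j(3)[unfolded G_def] k1 k(2)] by blast
    have "l' = l"
      using row_block_unique[OF sq _ l(1) l'(2) l(2)] l' k1 by auto
    then show ?thesis
      using k l' by auto
  qed
  then show ?thesis
    using reach R_sub l unfolding G_def[symmetric]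
    by (intro set_eqI) (unfold mem_mutually_reachable_Image, blast)
qed

text \<open>The right-hand side does not mention the form, so this is the uniqueness of the
  emblem.\<close>

lemma form_blocks_irreducible_btf:
  assumes irr: "irreducible_btf n A \<rho> \<kappa> p N"
    and \<tau>: "bij_betw \<tau> {1..n} {1..n}" "\<And>i. i \<in> {1..n} \<Longrightarrow> (i, \<tau> i) \<in> A"
  shows "form_blocks \<rho> \<kappa> p N =
    (\<lambda>R. (R, \<tau> ` R)) ` strong_components {1..n} (transversal_graph_edges n A \<tau>)"
proof -
  define G where "G = transversal_graph_edges n A \<tau>"
  have btf: "block_triangular_form n A \<rho> \<kappa> p N"
    using irr by (simp add: irreducible_btf_def)
  then have sq: "square_block_form n \<rho> \<kappa> p N"
    by (simp add: block_triangular_form_def)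
  have comp: "\<rho> ` index_block N l = mutually_reachable {1..n} G `` {i}"
    if "l \<in> {1..p}" "i \<in> \<rho> ` index_block N l" for l i
    unfolding G_def using btf \<tau> _ that
  proof (rule row_block_strong_component)
    show "indecomposable A \<tau> (\<rho> ` index_block N l)"
      using irr that(1) irreducible_diagonal_iff[OF btf \<tau> that(1)] by (simp add: irreducible_btf_def)
  qed
  have "(\<lambda>l. \<rho> ` index_block N l) ` {1..p} = strong_components {1..n} G"
  proof (intro equalityI subsetI)
    fix R assume "R \<in> (\<lambda>l. \<rho> ` index_block N l) ` {1..p}"
    then obtain l where l: "l \<in> {1..p}" "R = \<rho> ` index_block N l"
      by blast
    then obtain i where i: "i \<in> \<rho> ` index_block N l"
      using square_block_formD(5)[OF sq] by blast
    then have "i \<in> {1..n}"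
      using UN_row_blocks[OF sq] l by blast
    then show "R \<in> strong_components {1..n} G"
      unfolding strong_components_eq l(2) comp[OF l(1) i] by (rule quotientI)
  next
    fix R assume "R \<in> strong_components {1..n} G"
    then obtain i where i: "i \<in> {1..n}" "R = mutually_reachable {1..n} G `` {i}"
      unfolding strong_components_eq by (auto elim: quotientE)
    then obtain l where "l \<in> {1..p}" "i \<in> \<rho> ` index_block N l"
      using UN_row_blocks[OF sq] by blast
    then show "R \<in> (\<lambda>l. \<rho> ` index_block N l) ` {1..p}"
      using comp i by blast
  qed
  moreover have "form_blocks \<rho> \<kappa> p N =
      (\<lambda>R. (R, \<tau> ` R)) ` (\<lambda>l. \<rho> ` index_block N l) ` {1..p}"
    unfolding form_blocks_def image_image
    by (rule image_cong) (use btf_transversal_image[OF btf \<tau>] in \<open>auto simp: image_image\<close>)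
  ultimately show ?thesis
    by (simp add: G_def)
qed

text \<open>Contracting the strong components leaves an acyclic digraph. A topological order of it
  makes the pattern block-triangular, and each diagonal block is irreducible because strong
  components are indecomposable.\<close>

lemma exists_irreducible_btf:
  assumes \<tau>: "bij_betw \<tau> {1..n} {1..n}" "\<And>i. i \<in> {1..n} \<Longrightarrow> (i, \<tau> i) \<in> A"
  shows "\<exists>\<rho> \<kappa> p N. irreducible_btf n A \<rho> \<kappa> p N"
proof -
  define G where "G = transversal_graph_edges n A \<tau>"
  let ?Q = "strong_components {1..n} G"
  note eqv = equiv_mutually_reachable[of "{1..n}" G]
  have finQ: "finite ?Q"
    unfolding strong_components_eq
    by (rule finite_quotient) (auto simp: mutually_reachable_def)
  have G_sub: "G \<subseteq> {1..n} \<times> {1..n}"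
    by (auto simp: G_def transversal_graph_edges_def)
  \<comment> \<open>Sorting the strong components by decreasing number of reachable vertices is a
    topological sort.\<close>
  define key where "key R = - int (card (G\<^sup>* `` R))" for R
  obtain xs where xs: "set xs = ?Q" "distinct xs"
    using finite_distinct_list[OF finQ] by blast
  define ys where "ys = sort_key key xs"
  have ys: "set ys = ?Q" "distinct ys" "sorted (map key ys)"
    using xs by (auto simp: ys_def)
  define p where "p = length ys"
  \<comment> \<open>Blocks are numbered from 1, list positions from 0.\<close>
  define R where "R l = ys ! (l - 1)" for l
  have R_in: "R l \<in> ?Q" if "l \<in> {1..p}" for l
  proof -
    have "l - 1 < length ys"
      using that by (auto simp: p_def)
    then show ?thesis
      unfolding R_def ys(1)[symmetric] by (rule nth_mem)
  qed
  have R_inj: "R k \<noteq> R l" if "k \<in> {1..p}" "l \<in> {1..p}" "k \<noteq> l" for k l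
  proof -
    have "k - 1 < length ys" "l - 1 < length ys" "k - 1 \<noteq> l - 1"
      using that by (auto simp: p_def)
    then show ?thesis
      using ys(2) by (simp add: R_def nth_eq_iff_index_eq)
  qed
  have R_img: "R ` {1..p} = ?Q"
  proof (intro equalityI subsetI)
    fix X assume "X \<in> ?Q"
    then obtain k where k: "k < p" "X = ys ! k"
      using ys(1) by (metis in_set_conv_nth p_def)
    then have "Suc k \<in> {1..p}" "X = R (Suc k)"
      by (auto simp: R_def)
    then show "X \<in> R ` {1..p}"
      by blast
  qed (use R_in in blast)
  have R_sub: "R l \<subseteq> {1..n}" if "l \<in> {1..p}" for l
    using R_in[OF that] eqv by (metis Union_quotient Union_upper strong_components_eq)
  have disj: "disjoint_family_on R {1..p}"
    unfolding disjoint_family_on_def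
    using R_in R_inj quotient_disj[OF eqv] by (metis strong_components_eq)
  have un: "(\<Union>l\<in>{1..p}. R l) = {1..n}"
    unfolding R_img strong_components_eq by (rule Union_quotient[OF eqv])
  have ne: "R l \<noteq> {}" if "l \<in> {1..p}" for l
    using R_in[OF that] eqv by (metis in_quotient_imp_non_empty strong_components_eq)
  have inj: "inj_on \<tau> {1..n}" and sur: "\<tau> ` {1..n} = {1..n}"
    using \<tau>(1) by (auto simp: bij_betw_def)
  have disjC: "disjoint_family_on (\<lambda>l. \<tau> ` R l) {1..p}"
    unfolding disjoint_family_on_def
    using disj inj_on_image_Int[OF inj R_sub R_sub, symmetric]
    by (auto simp: disjoint_family_on_def)
  have unC: "(\<Union>l\<in>{1..p}. \<tau> ` R l) = {1..n}"
    using un sur by (metis image_UN)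
  have cardC: "card (\<tau> ` R l) = card (R l)" if "l \<in> {1..p}" for l
    using inj R_sub[OF that] by (metis card_image inj_on_subset)
  obtain \<rho> \<kappa> N where sq: "square_block_form n \<rho> \<kappa> p N"
    and bl: "\<forall>l\<in>{1..p}. \<rho> ` index_block N l = R l \<and> \<kappa> ` index_block N l = \<tau> ` R l"
    using exists_square_block_form[OF disj un disjC unC ne cardC] by blast
  \<comment> \<open>An entry below the block diagonal is an edge from \<open>R k\<close> to the
    earlier component \<open>R l\<close>. There is no way back, so \<open>R k\<close> reaches
    everything that \<open>R l\<close> reaches and also \<open>i\<close>, against the sorting by
    decreasing reach.\<close>
  have zero: "A \<inter> (R k \<times> \<tau> ` R l) = {}" if kl: "k \<in> {1..p}" "l \<in> {1..p}" "k > l" for k l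
  proof (rule ccontr)
    assume "A \<inter> (R k \<times> \<tau> ` R l) \<noteq> {}"
    then obtain i j where ij: "i \<in> R k" "j \<in> R l" "(i, \<tau> j) \<in> A"
      by blast
    then have ijn: "i \<in> {1..n}" "j \<in> {1..n}"
      using R_sub kl by blast+
    then have edge: "(i, j) \<in> G"
      using ij by (simp add: G_def transversal_graph_edges_def)
    have Rk: "R k = mutually_reachable {1..n} G `` {i}"
      using R_in[OF kl(1)] ij(1) by (rule strong_component_eq_Image)
    have Rl: "R l = mutually_reachable {1..n} G `` {j}"
      using R_in[OF kl(2)] ij(2) by (rule strong_component_eq_Image)
    have "R k \<noteq> R l"
      using R_inj kl by auto
    then have "\<not> ((i, j) \<in> G\<^sup>* \<and> (j, i) \<in> G\<^sup>*)"
      unfolding mutually_reachable_Image_eq_iff[OF ijn, symmetric] Rk[symmetric] Rl[symmetric] .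
    then have no_return: "(j, i) \<notin> G\<^sup>*"
      using r_into_rtrancl[OF edge] by blast
    have reach_sub: "G\<^sup>* `` R l \<subseteq> G\<^sup>* `` {j}"
      unfolding Rl by (auto simp: mutually_reachable_def intro: rtrancl_trans)
    have "G\<^sup>* `` {j} \<subseteq> G\<^sup>* `` R k"
      using ij(1) edge by (auto intro: converse_rtrancl_into_rtrancl)
    moreover have "i \<in> G\<^sup>* `` R k" "i \<notin> G\<^sup>* `` {j}"
      using ij(1) no_return by auto
    ultimately have "G\<^sup>* `` R l \<subset> G\<^sup>* `` R k"
      using reach_sub by blast
    moreover have "G\<^sup>* `` R k \<subseteq> {1..n}"
    proof
      fix y assume "y \<in> G\<^sup>* `` R k"
      then obtain x where x: "x \<in> R k" "(x, y) \<in> G\<^sup>*"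
        by blast
      from x(2) show "y \<in> {1..n}"
        by cases (use x R_sub[OF kl(1)] G_sub in auto)
    qed
    ultimately have "card (G\<^sup>* `` R l) < card (G\<^sup>* `` R k)"
      by (meson finite_atLeastAtMost finite_subset psubset_card_mono)
    moreover have "key (R l) \<le> key (R k)"
    proof -
      have "l - 1 \<le> k - 1" "k - 1 < length (map key ys)"
        using kl by (auto simp: p_def)
      from sorted_nth_mono[OF ys(3) this] show ?thesis
        using kl by (auto simp: R_def p_def)
    qed
    ultimately show False
      by (simp add: key_def)
  qed
  have btf: "block_triangular_form n A \<rho> \<kappa> p N"
    unfolding block_triangular_form_def using sq bl zero by auto
  have "irreducible_pattern (N l) (diagonal_subpattern A \<rho> \<kappa> N l)" if l: "l \<in> {1..p}" for l
  proof -
    have "\<rho> ` index_block N l \<in> strong_components {1..n} (transversal_graph_edges n A \<tau>)"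
      using bl l R_in[OF l] by (simp add: G_def)
    then have "indecomposable A \<tau> (\<rho> ` index_block N l)"
      by (rule indecomposable_strong_component)
    then show ?thesis
      using irreducible_diagonal_iff[OF btf \<tau> l] by blast
  qed
  then show ?thesis
    using btf unfolding irreducible_btf_def by blast
qed

text \<open>Existence and uniqueness together evaluate the definite description, for any transversal
  \<open>\<tau>\<close> inside \<open>A\<close>.\<close>

lemma irreducible_emblem_eq:
  assumes \<tau>: "bij_betw \<tau> {1..n} {1..n}" "\<And>i. i \<in> {1..n} \<Longrightarrow> (i, \<tau> i) \<in> A"
  shows "irreducible_emblem n A =
    (\<lambda>R. (R, \<tau> ` R)) ` strong_components {1..n} (transversal_graph_edges n A \<tau>)"
  unfolding irreducible_emblem_def
proof (rule the_equality)
  show "\<exists>\<rho> \<kappa> p N. irreducible_btf n A \<rho> \<kappa> p N \<and>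
      (\<lambda>R. (R, \<tau> ` R)) ` strong_components {1..n} (transversal_graph_edges n A \<tau>) =
        form_blocks \<rho> \<kappa> p N"
    using exists_irreducible_btf[OF \<tau>] form_blocks_irreducible_btf[OF _ \<tau>] by metis
qed (use form_blocks_irreducible_btf[OF _ \<tau>] in blast)

section \<open>Highest-value transversals\<close>

text \<open>The value \<open>\<infinity>\<close> has to be excluded because it absorbs
  \<open>-\<infinity>\<close> in sums of type \<open>ereal\<close>.\<close>

lemma sum_ereal_eq_MInf:
  fixes f :: "'a \<Rightarrow> ereal"
  assumes "finite T" "x \<in> T" "f x = -\<infinity>" "\<And>y. y \<in> T \<Longrightarrow> f y \<noteq> \<infinity>"
  shows "sum f T = -\<infinity>"
proof -
  have "sum f (T - {x}) \<noteq> \<infinity>"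
    using assms(1,4) by (auto simp: sum_Pinfty)
  then show ?thesis
    using assms(1-3) by (simp add: sum.remove)
qed

lemma finite_transversal: "transversal n T \<Longrightarrow> finite T"
  unfolding transversal_def by (meson finite_SigmaI finite_atLeastAtMost finite_subset)

lemma exists_highest_value_transversal:
  assumes "transversal n T"
  shows "\<exists>T. highest_value_transversal n \<sigma> T"
proof -
  let ?\<T> = "Collect (transversal n)"
  have fin: "finite ?\<T>"
    by (rule finite_subset[of _ "Pow ({1..n} \<times> {1..n})"]) (unfold transversal_def, blast, simp)
  then have "Max (transversal_value \<sigma> ` ?\<T>) \<in> transversal_value \<sigma> ` ?\<T>"
    using assms by (intro Max_in) auto
  then obtain T' where T': "transversal n T'"
      "Max (transversal_value \<sigma> ` ?\<T>) = transversal_value \<sigma> T'"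
    by blast
  have "transversal_value \<sigma> T'' \<le> transversal_value \<sigma> T'" if "transversal n T''" for T''
    unfolding T'(2)[symmetric] using fin that by (intro Max_ge) auto
  then show ?thesis
    using T'(1) unfolding highest_value_transversal_def by blast
qed

text \<open>Well-posedness supplies a transversal of finite value. The maximal value is therefore
  not \<open>-\<infinity>\<close>, whereas a single entry \<open>-\<infinity>\<close> would force it
  to be.\<close>

lemma highest_value_transversal_subset_sparsity_pattern:
  assumes sig: "signature_matrix n \<sigma>" and wp: "structurally_well_posed n \<sigma>"
    and T: "highest_value_transversal n \<sigma> T"
  shows "T \<subseteq> sparsity_pattern n \<sigma>"
proof -
  obtain T0 where T0: "transversal n T0" "\<forall>(i, j)\<in>T0. \<bar>\<sigma> i j\<bar> \<noteq> \<infinity>"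
    using wp unfolding structurally_well_posed_def by blast
  have "transversal_value \<sigma> T0 \<noteq> -\<infinity>"
  proof -
    have "\<bar>\<Sum>(i, j)\<in>T0. \<sigma> i j\<bar> \<noteq> \<infinity>"
      using T0(2) finite_transversal[OF T0(1)] by (auto simp: sum_Inf)
    then show ?thesis
      by (auto simp: transversal_value_def)
  qed
  moreover have "transversal_value \<sigma> T0 \<le> transversal_value \<sigma> T"
    using T T0(1) by (simp add: highest_value_transversal_def)
  ultimately have fin: "transversal_value \<sigma> T \<noteq> -\<infinity>"
    by auto
  have tr: "transversal n T"
    using T by (simp add: highest_value_transversal_def)
  then have T_sub: "T \<subseteq> {1..n} \<times> {1..n}"
    by (simp add: transversal_def)
  have no_PInf: "(case x of (i, j) \<Rightarrow> \<sigma> i j) \<noteq> \<infinity>" if "x \<in> T" for x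
    using sig that T_sub unfolding signature_matrix_def by fastforce
  have "\<sigma> i j \<noteq> -\<infinity>" if "(i, j) \<in> T" for i j
    using fin sum_ereal_eq_MInf[OF finite_transversal[OF tr] that, of "\<lambda>(i, j). \<sigma> i j"] no_PInf
    by (auto simp: transversal_value_def)
  then show ?thesis
    using T_sub by (auto simp: sparsity_pattern_def)
qed

section \<open>Strong components of the fine-block graph\<close>

theorem theorem5p9:
  fixes n :: nat and \<sigma> :: "nat \<Rightarrow> nat \<Rightarrow> ereal"
  assumes "signature_matrix n \<sigma>" and "structurally_well_posed n \<sigma>"
  shows "\<forall>B\<in>coarse_blocks n \<sigma>.
    \<exists>K\<in>strong_components (fine_blocks n \<sigma>) (fine_block_edges n \<sigma>). B = block_union K"
proof
  fix B assume B: "B \<in> coarse_blocks n \<sigma>"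
  let ?V = "{1..n}" and ?S = "sparsity_pattern n \<sigma>"
  obtain T where T: "highest_value_transversal n \<sigma> T"
    using assms(2) exists_highest_value_transversal
    unfolding structurally_well_posed_def by blast
  then have "transversal n T"
    by (simp add: highest_value_transversal_def)
  then obtain \<tau> where \<tau>: "bij_betw \<tau> ?V ?V" and T_eq: "T = {(i, \<tau> i) | i. i \<in> ?V}"
    by (rule transversal_eq_graph)
  have ess: "(i, \<tau> i) \<in> essential_pattern n \<sigma>" if "i \<in> ?V" for i
    using T that by (auto simp: essential_pattern_def T_eq)
  have ess_sub: "essential_pattern n \<sigma> \<subseteq> ?S"
    using highest_value_transversal_subset_sparsity_pattern[OF assms]
    by (auto simp: essential_pattern_def)
  have emblem: "irreducible_emblem n A =
      (\<lambda>R. (R, \<tau> ` R)) ` strong_components ?V (transversal_graph_edges n A \<tau>)"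
    if "\<And>i. i \<in> ?V \<Longrightarrow> (i, \<tau> i) \<in> A" for A
    using \<tau> that by (rule irreducible_emblem_eq)
  define G where "G = transversal_graph_edges n ?S \<tau>"
  define H where "H = transversal_graph_edges n (essential_pattern n \<sigma>) \<tau>"
  have "H \<subseteq> G"
    using ess_sub by (auto simp: G_def H_def transversal_graph_edges_def)
  then have HG: "H\<^sup>* \<subseteq> G\<^sup>*"
    by (rule rtrancl_mono)
  define cls where "cls i = mutually_reachable ?V H `` {i}" for i
  \<comment> \<open>The fine block containing row \<open>i\<close>. Rows of the same fine block give
    equal values, so \<open>blk\<close> is the contraction map from rows to vertices of the
    fine-block graph.\<close>
  define blk where "blk i = (cls i, \<tau> ` cls i)" for i
  let ?F = "fine_blocks n \<sigma>" and ?E = "fine_block_edges n \<sigma>"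
  have fine: "?F = blk ` ?V"
  proof -
    have "?F = (\<lambda>R. (R, \<tau> ` R)) ` strong_components ?V H"
      unfolding fine_blocks_def H_def by (rule emblem) (rule ess)
    then show ?thesis
      by (auto simp: strong_components_eq quotient_def blk_def cls_def)
  qed
  have cls_sub: "cls i \<subseteq> ?V" for i
    by (auto simp: cls_def mutually_reachable_def)
  have cls_self: "i \<in> cls i" if "i \<in> ?V" for i
    using that by (simp add: cls_def mutually_reachable_def)
  have cls_reach: "(i, j) \<in> G\<^sup>*" "(j, i) \<in> G\<^sup>*" if "j \<in> cls i" for i j
    using that HG by (auto simp: cls_def mutually_reachable_def)
  \<comment> \<open>The inequality is there because the fine-block graph has no loops, while
    \<open>G\<close> has edges inside blocks.\<close>
  have edge_iff: "(blk i, blk j) \<in> ?E \<longleftrightarrow> blk i \<noteq> blk j \<and> G \<inter> (cls i \<times> cls j) \<noteq> {}"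
    if "i \<in> ?V" "j \<in> ?V" for i j
  proof -
    have "?S \<inter> (cls i \<times> \<tau> ` cls j) \<noteq> {} \<longleftrightarrow> G \<inter> (cls i \<times> cls j) \<noteq> {}"
      using cls_sub[of i] cls_sub[of j] unfolding G_def transversal_graph_edges_def by blast
    moreover have "blk i \<in> ?F" "blk j \<in> ?F"
      using that by (simp_all add: fine)
    ultimately show ?thesis
      by (simp add: fine_block_edges_def) (simp add: blk_def)
  qed
  have lift: "(blk i, blk j) \<in> ?E\<^sup>*" if "(i, j) \<in> G\<^sup>*" for i j
    using that
  proof (induction rule: rtrancl_induct)
    case (step j k)
    have jk: "j \<in> ?V" "k \<in> ?V"
      using step(2) by (auto simp: G_def transversal_graph_edges_def)
    \<comment> \<open>An edge of \<open>G\<close> inside a fine block contracts to a path of length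
      zero.\<close>
    have "blk j = blk k \<or> (blk j, blk k) \<in> ?E"
      using edge_iff[OF jk] step(2) cls_self jk by blast
    then show ?case
      using step.IH by (auto intro: rtrancl.rtrancl_into_rtrancl)
  qed simp
  \<comment> \<open>Consecutive edges of a path of blocks need not meet in a row. The gaps are
    bridged inside each fine block, whose rows reach each other in \<open>H\<close> and hence in
    \<open>G\<close>.\<close>
  have unlift: "\<exists>j\<in>?V. c = blk j \<and> (i, j) \<in> G\<^sup>*" if "(blk i, c) \<in> ?E\<^sup>*" "i \<in> ?V" for i c
    using that(1)
  proof (induction rule: rtrancl_induct)
    case base
    then show ?case
      using that(2) by blast
  next
    case (step b c)
    obtain j where j: "j \<in> ?V" "b = blk j" "(i, j) \<in> G\<^sup>*"
      using step by blast
    have "c \<in> ?F"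
      using step(2) by (simp add: fine_block_edges_def)
    then obtain k where k: "k \<in> ?V" "c = blk k"
      unfolding fine by blast
    obtain x y where xy: "x \<in> cls j" "y \<in> cls k" "(x, y) \<in> G"
      using step(2) edge_iff[OF j(1) k(1)] j(2) k(2) by blast
    have "(i, k) \<in> G\<^sup>*"
      using j(3) cls_reach(1)[OF xy(1)] xy(3) cls_reach(2)[OF xy(2)]
      by (meson rtrancl.rtrancl_into_rtrancl rtrancl_trans)
    then show ?case
      using k by blast
  qed
  have reach_iff: "(blk i, blk j) \<in> ?E\<^sup>* \<longleftrightarrow> (i, j) \<in> G\<^sup>*"
    if ij: "i \<in> ?V" "j \<in> ?V" for i j
  proof
    assume "(blk i, blk j) \<in> ?E\<^sup>*"
    then obtain k where k: "k \<in> ?V" "blk j = blk k" "(i, k) \<in> G\<^sup>*"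
      using unlift ij(1) by blast
    \<comment> \<open>Equal blocks need not come from equal rows; \<open>j\<close> and
      \<open>k\<close> only share a class, and \<open>k\<close> reaches \<open>j\<close> within
      it.\<close>
    then have "j \<in> cls k"
      using cls_self[OF ij(2)] by (simp add: blk_def)
    then show "(i, j) \<in> G\<^sup>*"
      using k(3) cls_reach(1) by (meson rtrancl_trans)
  qed (rule lift)
  have spars: "(i, \<tau> i) \<in> ?S" if "i \<in> ?V" for i
    using ess[OF that] ess_sub by blast
  obtain q where q: "q \<in> ?V" and B_eq: "B = (mutually_reachable ?V G `` {q},
      \<tau> ` (mutually_reachable ?V G `` {q}))"
  proof -
    have "coarse_blocks n \<sigma> = (\<lambda>R. (R, \<tau> ` R)) ` strong_components ?V G"
      unfolding coarse_blocks_def G_def by (rule emblem) (rule spars)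
    then show ?thesis
      using B that unfolding strong_components_eq by (auto elim!: quotientE)
  qed
  \<comment> \<open>\<open>q\<close> is a row of the coarse block \<open>B\<close>, so the component
    sought is that of the fine block through \<open>q\<close>.\<close>
  define K where "K = mutually_reachable ?F ?E `` {blk q}"
  have K_in: "K \<in> strong_components ?F ?E"
    unfolding K_def strong_components_eq using fine q by (intro quotientI) blast
  have K_eq: "K = blk ` (mutually_reachable ?V G `` {q})"
  proof -
    have "blk j \<in> K \<longleftrightarrow> j \<in> mutually_reachable ?V G `` {q}" if "j \<in> ?V" for j
      using reach_iff[OF q that] reach_iff[OF that q] that q
      unfolding K_def mem_mutually_reachable_Image fine by blast
    moreover have "K \<subseteq> ?F" "mutually_reachable ?V G `` {q} \<subseteq> ?V"
      by (auto simp: K_def mutually_reachable_def)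
    ultimately show ?thesis
      unfolding fine by blast
  qed
  \<comment> \<open>As \<open>H\<close> is contained in \<open>G\<close>, the classes of
    \<open>H\<close> refine those of \<open>G\<close>.\<close>
  have rows: "(\<Union>i\<in>mutually_reachable ?V G `` {q}. cls i) = mutually_reachable ?V G `` {q}"
  proof (intro equalityI subsetI)
    fix j assume "j \<in> (\<Union>i\<in>mutually_reachable ?V G `` {q}. cls i)"
    then obtain i where i: "i \<in> mutually_reachable ?V G `` {q}" "j \<in> cls i"
      by blast
    then show "j \<in> mutually_reachable ?V G `` {q}"
      using cls_sub[of i] cls_reach[OF i(2)] unfolding mem_mutually_reachable_Image
      by (meson rtrancl_trans subsetD)
  next
    fix j assume j: "j \<in> mutually_reachable ?V G `` {q}"
    then have "j \<in> ?V"
      by (simp add: mutually_reachable_def)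
    then show "j \<in> (\<Union>i\<in>mutually_reachable ?V G `` {q}. cls i)"
      using j cls_self by blast
  qed
  \<comment> \<open>The columns need no separate argument: in both emblems they are
    \<open>\<tau>\<close>-images of the rows, and images commute with unions.\<close>
  have "block_union K = (\<Union>i\<in>mutually_reachable ?V G `` {q}. cls i,
      \<tau> ` (\<Union>i\<in>mutually_reachable ?V G `` {q}. cls i))"
    unfolding block_union_def K_eq by (simp add: blk_def image_UN)
  then have "B = block_union K"
    by (simp only: rows B_eq)
  then show "\<exists>K\<in>strong_components ?F ?E. B = block_union K"
    using K_in by blast
qed

end
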